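(* Let $a$ be an element of a ring $R$. The following are equivalent: (1) There exists $u\in U(R)$ with $aua=a$ such that, writing $e:=ua$ (an idempotent of $R$), the element $eae$ is unit-regular in $eRe$. (2) There exists $r\in R$ with $ara=a$ such that, writing $e:=ra$ (an idempotent of $R$), the element $eae$ is unit-regular in $eRe$. (3) There exist an idempotent $g\in R$ and a unit $v\in U(R)$ such that, putting $h:=1-g$, we have $g=gva$, $h=-hv(1-a)$, $hvh=-h$, and $gvhvgvh=-gvh$. (4) There exist an idempotent $e\in R$ and $u\in U(R)$ such that $a=e+u$, $aR\cap eR=(0)$, and $a^2R\cap aeR=(0)$. (5) There exist an idempotent $e\in R$ and $u\in U(R)$ such that $a=e+u$, $aR\cap eR=(0)$, and $a^2R\cap aeaR=(0)$. (6) There exist an idempotent $e\in R$ and $u\in U(R)$ such that $a=e+u$, $au^{-1}a=a$, and $a^2u^{-2}a^2=a^2$.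
   Context: Rings are associative with $1$, not necessarily commutative. $U(R)$ denotes the group of units of $R$. An element $b$ of a ring $S$ is unit-regular in $S$ if there is a unit $w\in U(S)$ with $bwb=b$. For an idempotent $e$, $eRe$ is the corner ring with identity $e$. *)

theory Defs
  imports "HOL-Algebra.Ring"
begin

definition idempotent_element :: "('a, 'm) ring_scheme \<Rightarrow> 'a \<Rightarrow> bool"
  where "idempotent_element R e \<longleftrightarrow> e \<in> carrier R \<and> e \<otimes>\<^bsub>R\<^esub> e = e"

definition unit_regular :: "('a, 'm) ring_scheme \<Rightarrow> 'a \<Rightarrow> bool"
  where "unit_regular S b \<longleftrightarrow>
    b \<in> carrier S \<and> (\<exists>w \<in> Units S. b \<otimes>\<^bsub>S\<^esub> w \<otimes>\<^bsub>S\<^esub> b = b)"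

definition corner :: "('a, 'm) ring_scheme \<Rightarrow> 'a \<Rightarrow> ('a, 'm) ring_scheme"
  where "corner R e =
    R\<lparr>carrier := {e \<otimes>\<^bsub>R\<^esub> x \<otimes>\<^bsub>R\<^esub> e | x. x \<in> carrier R}, one := e\<rparr>"

text \<open>The library's principal ideal \<open>PIdl\<close> consists of the left multiples \<open>x \<otimes> a\<close>;
  here we need the right multiples.\<close>

definition principal_right_ideal :: "('a, 'm) ring_scheme \<Rightarrow> 'a \<Rightarrow> 'a set"
  where "principal_right_ideal R a = {a \<otimes>\<^bsub>R\<^esub> x | x. x \<in> carrier R}"

definition all_equivalent :: "bool list \<Rightarrow> bool"
  where "all_equivalent Ps \<longleftrightarrow> (\<forall>P \<in> set Ps. \<forall>Q \<in> set Ps. P \<longleftrightarrow> Q)"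

lemma (in ring) corner_ring:
  assumes "idempotent_element R e"
  shows "ring (corner R e)"
proof -
  have e: "e \<in> carrier R" "e \<otimes> e = e"
    using assms by (auto simp: idempotent_element_def)
  have mem: "x \<in> carrier (corner R e) \<longleftrightarrow> x \<in> carrier R \<and> e \<otimes> x = x \<and> x \<otimes> e = x" for x
  proof
    assume "x \<in> carrier (corner R e)"
    then obtain y where y: "y \<in> carrier R" "x = e \<otimes> y \<otimes> e"
      by (auto simp: corner_def)
    have "e \<otimes> x = (e \<otimes> e) \<otimes> y \<otimes> e" "x \<otimes> e = e \<otimes> y \<otimes> (e \<otimes> e)"
      using y e(1) by (simp_all add: m_assoc del: e(2))
    then show "x \<in> carrier R \<and> e \<otimes> x = x \<and> x \<otimes> e = x"
      using y e by simp
  next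
    assume "x \<in> carrier R \<and> e \<otimes> x = x \<and> x \<otimes> e = x"
    then have "x \<in> carrier R" "x = e \<otimes> x \<otimes> e" by simp_all
    then show "x \<in> carrier (corner R e)"
      by (auto simp: corner_def)
  qed
  have ops: "\<And>x y. x \<otimes>\<^bsub>corner R e\<^esub> y = x \<otimes> y" "\<And>x y. x \<oplus>\<^bsub>corner R e\<^esub> y = x \<oplus> y"
    "\<zero>\<^bsub>corner R e\<^esub> = \<zero>" "\<one>\<^bsub>corner R e\<^esub> = e"
    by (simp_all add: corner_def)
  show ?thesis
  proof (rule ringI)
    show "abelian_group (corner R e)"
    proof (rule abelian_groupI, unfold mem ops)
      fix x assume x: "x \<in> carrier R \<and> e \<otimes> x = x \<and> x \<otimes> e = x"
      then show "\<exists>y\<in>carrier (corner R e). y \<oplus> x = \<zero>"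
        using e by (intro bexI[of _ "\<ominus> x"]) (auto simp: mem r_minus l_minus l_neg)
    qed (use e in \<open>auto simp: l_distr r_distr a_ac\<close>)
    show "monoid (corner R e)"
      by (rule monoidI, unfold mem ops) (use e in \<open>auto simp: m_assoc\<close>, simp add: m_assoc[symmetric])
  qed (use e in \<open>auto simp: mem ops l_distr r_distr\<close>)
qed

end

theory Submission imports Defs
begin

text \<open>Write \<open>a = e + u\<close> and \<open>w = u\<^sup>-\<^sup>1\<close>. The condition \<open>aR \<inter> eR = 0\<close> amounts to \<open>ewa = 0\<close>, so that
  \<open>wa = 1 + we\<close>, \<open>aw = 1 + ew\<close> and \<open>a\<^sup>2w\<^sup>2a\<^sup>2 - a\<^sup>2 = aeaw\<^sup>2a\<^sup>2\<close>; this element lies in \<open>a\<^sup>2R \<inter> aeaR\<close>,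
  whence (5) implies (6). Given (6), \<open>wawwa\<close> is an inner inverse of \<open>waa\<close> and a unit of the corner
  ring at \<open>wa\<close> with inverse \<open>(1 - e)a\<close>, which gives (1). Condition (3) is the same decomposition
  for \<open>v = w\<close>, \<open>h = weu\<close>; its last equation means \<open>aew\<^sup>2e = 0\<close>, which lies between (4) and (6).
  The step from (2) to (4) is a construction: \<open>a\<close> maps \<open>raR\<close> isomorphically onto \<open>aR\<close>, and
  unit-regularity in the corner provides an isomorphism between \<open>aR \<inter> ker a\<close> and a complement
  of \<open>aR + ker a\<close>, which allows one to choose a common complement suited to \<open>e\<close>.\<close>

section \<open>Preliminaries on right ideals, corners and products\<close>

text \<open>The implications form the cycle (1), (2), (4), (5), (6), (1); condition (3) is attached
  as a detour from (4) to (6).\<close>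

lemma all_equivalent_six:
  assumes "P1 \<Longrightarrow> P2" "P2 \<Longrightarrow> P4" "P4 \<Longrightarrow> P5" "P5 \<Longrightarrow> P6" "P6 \<Longrightarrow> P1" "P4 \<Longrightarrow> P3" "P3 \<Longrightarrow> P6"
  shows "all_equivalent [P1, P2, P3, P4, P5, P6]"
  using assms by (cases P1; cases P3) (auto simp: all_equivalent_def)

lemma (in ring) principal_right_ideals_disjoint:
  assumes "x \<in> carrier R" "y \<in> carrier R"
    and "\<And>i j. i \<in> carrier R \<Longrightarrow> j \<in> carrier R \<Longrightarrow> x \<otimes> i = y \<otimes> j \<Longrightarrow> x \<otimes> i = \<zero>"
  shows "principal_right_ideal R x \<inter> principal_right_ideal R y = {\<zero>}"
proof -
  have "\<zero> = x \<otimes> \<zero>" "\<zero> = y \<otimes> \<zero>"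
    using assms(1,2) by simp_all
  then show ?thesis
    using assms(3) unfolding principal_right_ideal_def by blast
qed

lemma (in ring) principal_right_ideals_disjointD:
  assumes "principal_right_ideal R x \<inter> principal_right_ideal R y = {\<zero>}"
    and "i \<in> carrier R" "j \<in> carrier R" "x \<otimes> i = y \<otimes> j"
  shows "x \<otimes> i = \<zero>"
  using assms unfolding principal_right_ideal_def by blast

lemma (in ring) mem_corner_iff:
  assumes "idempotent_element R p"
  shows "x \<in> carrier (corner R p) \<longleftrightarrow> x \<in> carrier R \<and> p \<otimes> x = x \<and> x \<otimes> p = x"
proof
  have p: "p \<in> carrier R" "p \<otimes> p = p"
    using assms by (auto simp: idempotent_element_def)
  show "x \<in> carrier R \<and> p \<otimes> x = x \<and> x \<otimes> p = x" if "x \<in> carrier (corner R p)"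
  proof -
    from that obtain y where y: "y \<in> carrier R" "x = p \<otimes> y \<otimes> p"
      by (auto simp: corner_def)
    have "p \<otimes> x = p \<otimes> p \<otimes> y \<otimes> p" "x \<otimes> p = p \<otimes> y \<otimes> (p \<otimes> p)"
      using y p(1) by (simp_all add: m_assoc)
    then show ?thesis
      using y p by simp
  qed
  show "x \<in> carrier (corner R p)" if "x \<in> carrier R \<and> p \<otimes> x = x \<and> x \<otimes> p = x"
  proof -
    have "x = p \<otimes> x \<otimes> p"
      using that by simp
    then show ?thesis
      using that unfolding corner_def by force
  qed
qed

lemma corner_simps [simp]:
  "x \<otimes>\<^bsub>corner R p\<^esub> y = x \<otimes>\<^bsub>R\<^esub> y" "\<one>\<^bsub>corner R p\<^esub> = p"
  by (simp_all add: corner_def)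

text \<open>Once products are nested to the right, the pair \<open>x \<otimes> y\<close> is no
  longer a subterm; this form lets a relation for it still rewrite.\<close>

lemma (in ring) mult_assoc_rule:
  assumes "x \<otimes> y = z" "x \<in> carrier R" "y \<in> carrier R" "i \<in> carrier R"
  shows "x \<otimes> (y \<otimes> i) = z \<otimes> i"
  using assms by (simp add: m_assoc[symmetric])

lemma (in ring) eq_addI:
  assumes "x \<ominus> y = z" "x \<in> carrier R" "y \<in> carrier R"
  shows "x = y \<oplus> z"
proof -
  have "y \<oplus> z = x"
    unfolding assms(1)[symmetric] using assms(2,3) by (simp add: minus_eq a_lcomm r_neg)
  then show ?thesis by simp
qed

section \<open>Identities of a clean decomposition with \<open>ewa = 0\<close>\<close>

text \<open>For a clean decomposition \<open>a = e + u\<close> with \<open>w = u\<^sup>-\<^sup>1\<close>, the condition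
  \<open>ewa = 0\<close> is another form of both \<open>aR \<inter> eR = 0\<close> and \<open>awa = a\<close>.\<close>

locale special_clean = ring R for R (structure) +
  fixes a e u w
  assumes closed [simp]: "e \<in> carrier R" "u \<in> carrier R" "w \<in> carrier R"
    and idem: "e \<otimes> e = e"
    and inverse: "u \<otimes> w = \<one>" "w \<otimes> u = \<one>"
    and decomp: "a = e \<oplus> u"
    and ewa: "e \<otimes> (w \<otimes> a) = \<zero>"
begin

lemma a_closed [simp]: "a \<in> carrier R"
  by (simp add: decomp)

lemma wa: "w \<otimes> a = \<one> \<oplus> w \<otimes> e"
  by (simp add: decomp r_distr inverse a_comm)

lemma aw: "a \<otimes> w = \<one> \<oplus> e \<otimes> w"
  by (simp add: decomp l_distr inverse a_comm)

lemma ewe: "e \<otimes> (w \<otimes> e) = \<ominus> e"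
proof -
  have "e \<oplus> e \<otimes> (w \<otimes> e) = \<zero>"
    using ewa by (simp add: wa r_distr)
  then show ?thesis
    by (metis closed(1) closed(3) m_closed minus_equality minus_minus a_comm)
qed

lemma awe: "a \<otimes> (w \<otimes> e) = \<zero>"
proof -
  have "a \<otimes> (w \<otimes> e) = a \<otimes> w \<otimes> e"
    by (simp add: m_assoc)
  also have "\<dots> = e \<oplus> e \<otimes> (w \<otimes> e)"
    by (simp add: aw l_distr m_assoc)
  finally show ?thesis
    by (simp add: ewe r_neg)
qed

lemma awa: "a \<otimes> (w \<otimes> a) = a"
  by (simp add: wa r_distr awe)

text \<open>The relations with a trailing factor, ready for use in right-nested products.\<close>

lemma rules:
  assumes [simp]: "i \<in> carrier R"
  shows "e \<otimes> (e \<otimes> i) = e \<otimes> i" "u \<otimes> (w \<otimes> i) = i" "w \<otimes> (u \<otimes> i) = i"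
    "e \<otimes> (w \<otimes> (a \<otimes> i)) = \<zero>" "e \<otimes> (w \<otimes> (e \<otimes> i)) = \<ominus> (e \<otimes> i)"
    "a \<otimes> (w \<otimes> (e \<otimes> i)) = \<zero>" "a \<otimes> (w \<otimes> (a \<otimes> i)) = a \<otimes> i"
proof -
  have *: "x \<otimes> (y \<otimes> (z \<otimes> i)) = x \<otimes> (y \<otimes> z) \<otimes> i"
    if "x \<in> carrier R" "y \<in> carrier R" "z \<in> carrier R" for x y z
    using that by (simp add: m_assoc)
  show "e \<otimes> (e \<otimes> i) = e \<otimes> i" "u \<otimes> (w \<otimes> i) = i" "w \<otimes> (u \<otimes> i) = i"
    by (simp_all add: m_assoc[symmetric] idem inverse)
  show "e \<otimes> (w \<otimes> (a \<otimes> i)) = \<zero>" "e \<otimes> (w \<otimes> (e \<otimes> i)) = \<ominus> (e \<otimes> i)"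
    "a \<otimes> (w \<otimes> (e \<otimes> i)) = \<zero>" "a \<otimes> (w \<otimes> (a \<otimes> i)) = a \<otimes> i"
    by (simp_all add: * ewa ewe awe awa l_minus)
qed

lemmas simp_rules = m_assoc idem inverse ewa ewe awe awa rules

lemma aw_mult: "i \<in> carrier R \<Longrightarrow> a \<otimes> (w \<otimes> i) = i \<oplus> e \<otimes> (w \<otimes> i)"
  by (simp add: m_assoc[symmetric] aw l_distr)

lemma wa_mult: "i \<in> carrier R \<Longrightarrow> w \<otimes> (a \<otimes> i) = i \<oplus> w \<otimes> (e \<otimes> i)"
  by (simp add: m_assoc[symmetric] wa l_distr)

text \<open>Left multiplication by \<open>ew\<close> annihilates \<open>aR\<close> and acts as -1 on
  \<open>eR\<close>.\<close>

lemma a_disjoint_e: "principal_right_ideal R a \<inter> principal_right_ideal R e = {\<zero>}"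
proof (rule principal_right_ideals_disjoint)
  fix i j assume ij: "i \<in> carrier R" "j \<in> carrier R" "a \<otimes> i = e \<otimes> j"
  have "e \<otimes> (w \<otimes> (a \<otimes> i)) = e \<otimes> (w \<otimes> (e \<otimes> j))"
    by (simp add: ij(3))
  then have "\<ominus> (e \<otimes> j) = \<zero>"
    using ij(1,2) by (simp add: simp_rules)
  then show "a \<otimes> i = \<zero>"
    using ij by (metis closed(1) m_closed minus_minus minus_zero)
qed simp_all

text \<open>With \<open>y = waa\<close>, the relation \<open>aw = 1 + ew\<close> turns
  \<open>aawy\<close> into \<open>ay + aewy\<close>. As \<open>ey = 0\<close>, the same relation
  gives \<open>eawy = ewy\<close>, so the extra term is \<open>aeawy\<close>.\<close>

lemma double_square:
  "a \<otimes> a \<otimes> (w \<otimes> w \<otimes> (a \<otimes> a)) = a \<otimes> a \<oplus> a \<otimes> e \<otimes> a \<otimes> (w \<otimes> w \<otimes> (a \<otimes> a))"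
proof -
  define y where "y = w \<otimes> (a \<otimes> a)"
  have y: "y \<in> carrier R" "a \<otimes> y = a \<otimes> a" "e \<otimes> y = \<zero>"
    by (simp_all add: y_def simp_rules)
  have "a \<otimes> (a \<otimes> (w \<otimes> y)) = a \<otimes> y \<oplus> a \<otimes> (e \<otimes> (w \<otimes> y))"
    using y(1) by (simp add: aw_mult r_distr)
  moreover have "a \<otimes> (e \<otimes> (a \<otimes> (w \<otimes> y))) = a \<otimes> (e \<otimes> (w \<otimes> y))"
    using y(1,3) by (simp add: aw_mult r_distr simp_rules)
  ultimately show ?thesis
    using y by (simp add: m_assoc y_def)
qed

text \<open>The error term \<open>aeawwaa\<close> of \<open>double_square\<close> simplifies to
  \<open>aewwea\<close>, a right multiple of \<open>aewwe\<close>.\<close>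

lemma aewwe_imp_double_square:
  assumes "a \<otimes> (e \<otimes> (w \<otimes> (w \<otimes> e))) = \<zero>"
  shows "a \<otimes> a \<otimes> (w \<otimes> w \<otimes> (a \<otimes> a)) = a \<otimes> a"
proof -
  have *: "a \<otimes> (e \<otimes> (w \<otimes> (w \<otimes> (e \<otimes> a)))) = \<zero>"
    using arg_cong[OF assms, of "\<lambda>x. x \<otimes> a"] by (simp add: m_assoc)
  have "e \<otimes> (a \<otimes> (w \<otimes> (w \<otimes> (a \<otimes> a)))) = e \<otimes> (w \<otimes> (w \<otimes> (e \<otimes> a)))"
    by (simp add: aw_mult[of "w \<otimes> (a \<otimes> a)"] r_distr simp_rules)
      (simp add: wa_mult r_distr simp_rules)
  then show ?thesis
    using * double_square by (simp add: m_assoc)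
qed

text \<open>For \<open>y = ewwe\<close> one has \<open>ey = y\<close>, hence
  \<open>ay = y + uy = u(1 + w)y\<close>, and \<open>u\<close> is invertible.\<close>

lemma aewwe_iff:
  "(\<one> \<oplus> w) \<otimes> (e \<otimes> (w \<otimes> (w \<otimes> e))) = \<zero> \<longleftrightarrow> a \<otimes> (e \<otimes> (w \<otimes> (w \<otimes> e))) = \<zero>"
proof -
  define y where "y = e \<otimes> (w \<otimes> (w \<otimes> e))"
  have y: "y \<in> carrier R" "e \<otimes> y = y"
    by (simp_all add: y_def simp_rules)
  have "a \<otimes> y = y \<oplus> u \<otimes> y"
    using y by (simp add: decomp l_distr)
  also have "\<dots> = u \<otimes> ((\<one> \<oplus> w) \<otimes> y)"
    using y(1) by (simp add: l_distr r_distr simp_rules a_comm)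
  finally have ay: "a \<otimes> y = u \<otimes> ((\<one> \<oplus> w) \<otimes> y)" .
  moreover have "(\<one> \<oplus> w) \<otimes> y = w \<otimes> (a \<otimes> y)"
    using y(1) by (simp add: ay simp_rules)
  ultimately show ?thesis
    unfolding y_def[symmetric] by (metis r_null closed(2,3))
qed

text \<open>In the notation of condition (3), \<open>v = w\<close> and \<open>h = weu\<close>.\<close>

lemma gvh_iff:
  defines "h \<equiv> w \<otimes> e \<otimes> u"
  defines "g \<equiv> \<one> \<ominus> h"
  shows "g \<otimes> w \<otimes> h \<otimes> w \<otimes> g \<otimes> w \<otimes> h = \<ominus> (g \<otimes> w \<otimes> h) \<longleftrightarrow>
    a \<otimes> (e \<otimes> (w \<otimes> (w \<otimes> e))) = \<zero>"
proof -
  \<comment> \<open>Since \<open>gwh = Xu\<close> and \<open>uw = 1\<close>, the condition reads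
    \<open>XX = -X\<close>. From \<open>Xe = X\<close> and \<open>eX = ewwe - e\<close> one gets
    \<open>XX = Y - X\<close>, so it reduces to \<open>Y = 0\<close>.\<close>
  define X where "X = w \<otimes> (w \<otimes> e) \<oplus> w \<otimes> e"
  define Y where "Y = X \<otimes> (e \<otimes> (w \<otimes> (w \<otimes> e)))"
  have closed' [simp]: "X \<in> carrier R" "h \<in> carrier R" "g \<in> carrier R" "Y \<in> carrier R"
    by (simp_all add: X_def h_def g_def Y_def)
  have gwh: "g \<otimes> w \<otimes> h = X \<otimes> u"
    by (simp add: g_def h_def X_def minus_eq l_distr r_distr l_minus r_minus simp_rules)
  have Xe: "X \<otimes> e = X"
    by (simp add: X_def l_distr simp_rules)
  have XX: "X \<otimes> X = Y \<ominus> X"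
  proof -
    have "X \<otimes> X = X \<otimes> e \<otimes> X"
      by (simp add: Xe)
    also have "\<dots> = X \<otimes> (e \<otimes> X)"
      by (simp add: m_assoc)
    also have "e \<otimes> X = e \<otimes> (w \<otimes> (w \<otimes> e)) \<ominus> e"
      by (simp add: X_def r_distr simp_rules minus_eq)
    finally show ?thesis
      by (simp add: Y_def minus_eq r_distr r_minus Xe)
  qed
  have "g \<otimes> w \<otimes> h \<otimes> w \<otimes> g \<otimes> w \<otimes> h = X \<otimes> u \<otimes> w \<otimes> (g \<otimes> w \<otimes> h)"
    by (simp add: gwh[symmetric] m_assoc)
  also have "\<dots> = (X \<otimes> X) \<otimes> u"
    by (simp add: gwh simp_rules)
  finally have 1: "g \<otimes> w \<otimes> h \<otimes> w \<otimes> g \<otimes> w \<otimes> h = \<ominus> (g \<otimes> w \<otimes> h) \<longleftrightarrow>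
      (X \<otimes> X) \<otimes> u = (\<ominus> X) \<otimes> u"
    by (simp add: gwh l_minus)
  have "(X \<otimes> X) \<otimes> u = (\<ominus> X) \<otimes> u \<longleftrightarrow> X \<otimes> X = \<ominus> X"
    by (metis (no_types) m_assoc closed(2,3) closed'(1) inverse(1) r_one m_closed a_inv_closed)
  also have "\<dots> \<longleftrightarrow> Y = \<zero>"
    by (simp add: XX minus_eq)
  also have "Y = w \<otimes> ((\<one> \<oplus> w) \<otimes> (e \<otimes> (w \<otimes> (w \<otimes> e))))"
    by (simp add: Y_def X_def l_distr r_distr simp_rules a_comm)
  also have "\<dots> = \<zero> \<longleftrightarrow> (\<one> \<oplus> w) \<otimes> (e \<otimes> (w \<otimes> (w \<otimes> e))) = \<zero>"
    by (metis closed a_closed add.m_closed m_closed one_closed r_null rules(2))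
  finally show ?thesis
    using 1 aewwe_iff by simp
qed

lemma unit_regular_corner:
  assumes "a \<otimes> a \<otimes> (w \<otimes> w \<otimes> (a \<otimes> a)) = a \<otimes> a"
  shows "unit_regular (corner R (w \<otimes> a)) (w \<otimes> a \<otimes> a \<otimes> (w \<otimes> a))"
proof -
  let ?p = "w \<otimes> a" and ?x = "w \<otimes> a \<otimes> w \<otimes> (w \<otimes> a)" and ?y = "(\<one> \<ominus> e) \<otimes> a"
  have p: "idempotent_element R ?p"
    by (simp add: idempotent_element_def simp_rules)
  note mem = mem_corner_iff[OF p]
  have x: "?x \<in> carrier (corner R ?p)"
    by (simp add: mem simp_rules)
  \<comment> \<open>Here \<open>p = 1 + we\<close>, and \<open>e\<close> annihilates
    \<open>1 - e\<close>.\<close>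
  have pe: "?p \<otimes> (\<one> \<ominus> e) = \<one> \<ominus> e"
    by (simp add: wa l_distr r_distr minus_eq r_minus simp_rules minus_add a_ac r_neg r_neg2)
  have y: "?y \<in> carrier (corner R ?p)"
  proof -
    have "?p \<otimes> ?y = ?p \<otimes> (\<one> \<ominus> e) \<otimes> a"
      by (simp add: m_assoc)
    then show ?thesis
      unfolding mem pe by (simp add: simp_rules)
  qed
  have u: "?y = (\<one> \<ominus> e) \<otimes> u"
    by (simp add: decomp minus_eq l_distr r_distr l_minus simp_rules minus_add a_ac r_neg r_neg2)
  have "?x \<otimes> ?y = ?p"
  proof -
    have "?x \<otimes> ?y = w \<otimes> a \<otimes> w \<otimes> (?p \<otimes> (\<one> \<ominus> e)) \<otimes> a"
      by (simp add: m_assoc)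
    then show ?thesis
      unfolding pe by (simp add: minus_eq l_distr r_distr l_minus r_minus simp_rules)
  qed
  moreover have "?y \<otimes> ?x = ?p"
  proof -
    have "?y \<otimes> ?x = ?y \<otimes> (w \<otimes> (w \<otimes> a))"
      by (simp add: simp_rules)
    also have "\<dots> = ?p"
      unfolding u by (simp add: simp_rules) (simp add: minus_eq l_distr l_minus simp_rules)
    finally show ?thesis .
  qed
  ultimately have "?x \<in> Units (corner R ?p)"
    using x y by (auto simp: Units_def)
  \<comment> \<open>Absorbing \<open>awa = a\<close> on both sides of the middle factor reduces the
    product to \<open>waawwaa\<close>, where the assumption applies.\<close>
  moreover have "w \<otimes> a \<otimes> a \<otimes> (w \<otimes> a) \<otimes> ?x \<otimes> (w \<otimes> a \<otimes> a \<otimes> (w \<otimes> a)) = w \<otimes> a \<otimes> a \<otimes> (w \<otimes> a)"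
    using assms by (simp add: simp_rules)
  ultimately show ?thesis
    unfolding unit_regular_def corner_simps by (intro conjI bexI) (simp_all add: mem simp_rules)
qed

end

section \<open>Two criteria for \<open>ewa = 0\<close>\<close>

text \<open>With \<open>w = inv u\<close>, substituting \<open>a = e + u\<close> in the first factor
  gives \<open>awa = ewa + a\<close>, so \<open>awa = a\<close> forces
  \<open>ewa = 0\<close>.\<close>

lemma (in ring) special_cleanI:
  assumes "idempotent_element R e" "u \<in> Units R" "a = e \<oplus> u"
    and "a \<otimes> inv u \<otimes> a = a"
  shows "special_clean R a e u (inv u)"
proof -
  have [simp]: "e \<in> carrier R" "u \<in> carrier R" "inv u \<in> carrier R" "a \<in> carrier R"
    using assms by (auto simp: idempotent_element_def)
  have "e \<otimes> (inv u \<otimes> a) \<oplus> a = \<zero> \<oplus> a"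
    using assms by (simp add: l_distr flip: m_assoc)
  then have "e \<otimes> (inv u \<otimes> a) = \<zero>"
    by (simp del: l_zero)
  then show ?thesis
    using assms by unfold_locales (auto simp: idempotent_element_def)
qed

text \<open>With \<open>w = inv u\<close>, the identity \<open>a(wa - 1) = ewa\<close> places
  \<open>ewa\<close> in both \<open>aR\<close> and \<open>eR\<close>.\<close>

lemma (in ring) special_cleanI_disjoint:
  assumes "idempotent_element R e" "u \<in> Units R" "a = e \<oplus> u"
    and "principal_right_ideal R a \<inter> principal_right_ideal R e = {\<zero>}"
  shows "special_clean R a e u (inv u)"
proof -
  have [simp]: "e \<in> carrier R" "u \<in> carrier R" "inv u \<in> carrier R" "a \<in> carrier R"
    using assms by (auto simp: idempotent_element_def)
  have *: "a \<otimes> (inv u \<otimes> a \<ominus> \<one>) = e \<otimes> (inv u \<otimes> a)"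
  proof -
    have "a \<otimes> inv u = \<one> \<oplus> e \<otimes> inv u"
      using assms(2,3) by (simp add: l_distr a_comm)
    then have "a \<otimes> (inv u \<otimes> a) = a \<oplus> e \<otimes> (inv u \<otimes> a)"
      by (simp add: l_distr flip: m_assoc)
    then show ?thesis
      by (simp add: minus_eq r_distr r_minus a_ac r_neg2)
  qed
  then have "a \<otimes> (inv u \<otimes> a \<ominus> \<one>) = \<zero>"
    by (rule principal_right_ideals_disjointD[OF assms(4), rotated 2]) simp_all
  with * have "e \<otimes> (inv u \<otimes> a) = \<zero>"
    by simp
  then show ?thesis
    using assms by unfold_locales (auto simp: idempotent_element_def)
qed


section \<open>A clean decomposition from a unit-regular corner element\<close>

text \<open>Regard \<open>R\<close> as a module over itself, with elements acting from the left. Then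
  \<open>R = W \<oplus> K\<close> with \<open>W = pR\<close> and \<open>K = ker a\<close>, and \<open>a\<close> has components \<open>c : W \<rightarrow> W\<close> and
  \<open>b : W \<rightarrow> K\<close>. Here \<open>z\<close> projects \<open>W\<close> onto \<open>ker c\<close>, \<open>szt\<close> projects \<open>W\<close> onto the complement
  \<open>szW\<close> of \<open>cW\<close>, and \<open>M\<close> projects \<open>K\<close> onto a complement of \<open>bzW = aR \<inter> K\<close>.
  The element \<open>e\<close> is the projection onto \<open>szW \<oplus> MK\<close> along \<open>{y + bzty | y \<in> W}\<close>; both of
  these are chosen complementary to \<open>aR\<close> and \<open>K\<close>, respectively.\<close>

locale corner_unit_regular = ring R for R (structure) +
  fixes a r p t s
  assumes closed [simp]: "a \<in> carrier R" "r \<in> carrier R" "t \<in> carrier R" "s \<in> carrier R"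
    and ara: "a \<otimes> r \<otimes> a = a"
    and p_def: "p = r \<otimes> a"
    and corner: "p \<otimes> t = t" "t \<otimes> p = t" "p \<otimes> s = s" "s \<otimes> p = s"
    and inverse: "t \<otimes> s = p" "s \<otimes> t = p"
    and regular: "p \<otimes> a \<otimes> t \<otimes> (p \<otimes> a) = p \<otimes> a"
begin

definition "c = p \<otimes> a"
definition "b = (\<one> \<ominus> p) \<otimes> a"
text \<open>The component of \<open>r\<close> from \<open>K\<close> to \<open>W\<close>. It undoes
  \<open>b\<close> on the kernel of \<open>c\<close>, which makes \<open>bz\<rho>\<close> a
  projection onto \<open>bzW\<close>.\<close>

definition "\<rho> = p \<otimes> r \<otimes> (\<one> \<ominus> p)"
definition "z = p \<ominus> t \<otimes> c"
definition "M = \<one> \<ominus> p \<ominus> b \<otimes> z \<otimes> \<rho>"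
definition "e = s \<otimes> z \<otimes> t \<oplus> (M \<ominus> s \<otimes> z \<otimes> \<rho>)"
text \<open>The future inverse of \<open>a - e\<close>. Let \<open>q = p + bzt\<close>, the
  projection along \<open>K\<close> onto the graph \<open>{y + bzty}\<close>. On
  \<open>R = aR \<oplus> eR\<close>, \<open>w\<close> is prescribed by \<open>wa = q\<close> and
  \<open>we = q - 1\<close>, whose difference is 1. The first summand kills \<open>eR\<close>, the
  second kills \<open>aR\<close>.\<close>

definition "w = (p \<oplus> b \<otimes> z \<otimes> t) \<otimes> (t \<ominus> z \<otimes> \<rho> \<otimes> b \<otimes> t \<oplus> z \<otimes> \<rho>)
  \<oplus> (M \<otimes> (b \<otimes> t \<oplus> p \<ominus> \<one>) \<oplus> b \<otimes> z \<otimes> t)"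

lemma p_closed [simp]: "p \<in> carrier R"
  by (simp add: p_def)

lemma closed' [simp]: "c \<in> carrier R" "b \<in> carrier R" "\<rho> \<in> carrier R" "z \<in> carrier R"
  "M \<in> carrier R" "e \<in> carrier R" "w \<in> carrier R"
  by (simp_all add: c_def b_def \<rho>_def z_def M_def e_def w_def)

lemma ap: "a \<otimes> p = a"
  using ara by (simp add: p_def m_assoc)

lemma pp: "p \<otimes> p = p"
  using ap by (simp add: p_def m_assoc)

lemma pc: "p \<otimes> c = c"
  by (simp add: c_def pp flip: m_assoc)

lemma cp: "c \<otimes> p = c"
  by (simp add: c_def ap m_assoc)

lemma pb: "p \<otimes> b = \<zero>"
  by (simp add: b_def minus_eq l_distr r_distr l_minus r_minus pp r_neg flip: m_assoc)

lemma bp: "b \<otimes> p = b"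
  by (simp add: b_def ap m_assoc)

lemma p\<rho>: "p \<otimes> \<rho> = \<rho>"
  by (simp add: \<rho>_def pp flip: m_assoc)

lemma \<rho>p: "\<rho> \<otimes> p = \<zero>"
  by (simp add: \<rho>_def minus_eq l_distr r_distr l_minus r_minus pp r_neg m_assoc)

lemma pz: "p \<otimes> z = z"
  by (simp add: z_def minus_eq r_distr r_minus pp corner flip: m_assoc)

lemma zp: "z \<otimes> p = z"
  by (simp add: z_def minus_eq l_distr l_minus pp cp m_assoc)

lemma cz: "c \<otimes> z = \<zero>"
  using regular by (simp add: z_def minus_eq r_distr r_minus cp r_neg flip: m_assoc c_def)

lemma zz: "z \<otimes> z = z"
proof -
  have "z \<otimes> z = p \<otimes> z \<ominus> t \<otimes> (c \<otimes> z)"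
    by (subst (1) z_def) (simp add: minus_eq l_distr l_minus m_assoc)
  then show ?thesis
    by (simp add: cz pz minus_eq)
qed

lemma tc: "t \<otimes> c = p \<ominus> z"
  by (simp add: z_def minus_eq minus_add r_neg2)

lemma ztc: "z \<otimes> (t \<otimes> c) = \<zero>"
  by (simp add: tc minus_eq r_distr r_minus zp zz r_neg)

text \<open>Conjugating \<open>z = p - tc\<close> by the corner unit \<open>s\<close> gives
  \<open>szt = p - ct\<close>, the projection complementary to \<open>ct\<close>.\<close>

lemma ct: "c \<otimes> t = p \<ominus> s \<otimes> (z \<otimes> t)"
proof -
  have "s \<otimes> (z \<otimes> t) = s \<otimes> (p \<otimes> t) \<ominus> s \<otimes> t \<otimes> c \<otimes> t"
    by (simp add: z_def minus_eq l_distr r_distr l_minus r_minus m_assoc)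
  then show ?thesis
    by (simp add: corner inverse pc minus_eq minus_add r_neg2)
qed

lemma a_eq: "a = c \<oplus> b"
  by (simp add: c_def b_def minus_eq l_distr l_minus a_lcomm r_neg)

lemma a_mult: "x \<in> carrier R \<Longrightarrow> a \<otimes> x = c \<otimes> x \<oplus> b \<otimes> x"
  using arg_cong[OF a_eq, of "\<lambda>y. y \<otimes> x"] by (simp add: l_distr)

lemma mult_a: "x \<in> carrier R \<Longrightarrow> x \<otimes> a = x \<otimes> c \<oplus> x \<otimes> b"
  using arg_cong[OF a_eq, of "\<lambda>y. x \<otimes> y"] by (simp add: r_distr)

lemma ra_mult: "x \<in> carrier R \<Longrightarrow> r \<otimes> (a \<otimes> x) = p \<otimes> x"
  by (rule mult_assoc_rule) (simp_all add: p_def[symmetric])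

text \<open>Because \<open>cz = 0\<close>, the product \<open>bz\<close> equals \<open>az\<close>,
  and \<open>ra = p\<close> recovers \<open>z\<close> from it.\<close>

lemma \<rho>bz: "\<rho> \<otimes> (b \<otimes> z) = z"
proof -
  have "b \<otimes> z = a \<otimes> z"
    by (simp add: a_mult cz)
  then have "p \<otimes> (r \<otimes> (b \<otimes> z)) = z"
    by (simp add: ra_mult pz)
  moreover have "p \<otimes> (b \<otimes> z) = \<zero>"
    by (simp add: pb flip: m_assoc)
  ultimately show ?thesis
    by (simp add: \<rho>_def minus_eq l_distr r_distr l_minus r_minus m_assoc)
qed

lemmas pair_rules = corner inverse ap pp pc cp pb bp p\<rho> \<rho>p pz zp cz zz ct tc

lemma triple_rules:
  assumes "i \<in> carrier R"
  shows "z \<otimes> (t \<otimes> (c \<otimes> i)) = \<zero>" "\<rho> \<otimes> (b \<otimes> (z \<otimes> i)) = z \<otimes> i"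
  using assms mult_assoc_rule[OF ztc] mult_assoc_rule[OF \<rho>bz] by (simp_all add: m_assoc)

lemmas simp_rules = m_assoc pair_rules pair_rules[THEN mult_assoc_rule] ztc \<rho>bz triple_rules
  minus_eq minus_add l_distr r_distr l_minus r_minus

lemma aM: "a \<otimes> M = \<zero>"
proof -
  have "a \<otimes> b = a \<otimes> p \<otimes> b"
    by (simp add: ap)
  also have "\<dots> = \<zero>"
    by (simp add: m_assoc pb)
  finally have "a \<otimes> b = \<zero>" .
  from mult_assoc_rule[OF this] show ?thesis
    by (simp add: M_def simp_rules r_neg)
qed

lemma Mp: "M \<otimes> p = \<zero>"
  by (simp add: M_def simp_rules r_neg)

lemma pM: "p \<otimes> M = \<zero>"
  by (simp add: M_def simp_rules r_neg)

lemma \<rho>M: "z \<otimes> (\<rho> \<otimes> M) = \<zero>"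
  by (simp add: M_def simp_rules r_neg)

text \<open>Both \<open>p\<close> and \<open>z\<rho>\<close> vanish on the image of
  \<open>M\<close>, where \<open>1 - p - bz\<rho>\<close> is therefore the identity.\<close>

lemma MM: "M \<otimes> M = M"
proof -
  have "M \<otimes> M = M \<ominus> p \<otimes> M \<ominus> b \<otimes> (z \<otimes> (\<rho> \<otimes> M))"
    by (subst (1) M_def) (simp add: minus_eq l_distr l_minus m_assoc)
  then show ?thesis
    by (simp add: pM \<rho>M minus_eq)
qed

text \<open>Evaluate \<open>xpy\<close> in two ways: one factor absorbs \<open>p\<close>, the other
  is annihilated by it.\<close>

lemma mult_p_eq_zero: "x \<otimes> y = \<zero>"
  if "x \<otimes> p = x \<and> p \<otimes> y = \<zero> \<or> x \<otimes> p = \<zero> \<and> p \<otimes> y = y" "x \<in> carrier R" "y \<in> carrier R"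
proof -
  have "x \<otimes> p \<otimes> y = x \<otimes> (p \<otimes> y)"
    using that(2,3) by (simp add: m_assoc)
  with that show ?thesis
    by auto
qed

text \<open>In each product the right factor lands in one of \<open>W\<close>, \<open>K\<close>
  while the left factor vanishes there.\<close>

lemma orthogonal:
  "t \<otimes> M = \<zero>" "s \<otimes> M = \<zero>" "c \<otimes> M = \<zero>" "b \<otimes> M = \<zero>" "z \<otimes> M = \<zero>"
  "t \<otimes> b = \<zero>" "s \<otimes> b = \<zero>" "c \<otimes> b = \<zero>" "b \<otimes> b = \<zero>" "z \<otimes> b = \<zero>"
  "M \<otimes> t = \<zero>" "M \<otimes> s = \<zero>" "M \<otimes> c = \<zero>" "M \<otimes> \<rho> = \<zero>" "M \<otimes> z = \<zero>"
  "\<rho> \<otimes> t = \<zero>" "\<rho> \<otimes> s = \<zero>" "\<rho> \<otimes> c = \<zero>" "\<rho> \<otimes> \<rho> = \<zero>" "\<rho> \<otimes> z = \<zero>"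
  by (rule mult_p_eq_zero; simp add: corner cp bp zp pM pb Mp \<rho>p pc p\<rho> pz)+

lemma Mbz: "M \<otimes> (b \<otimes> z) = \<zero>"
  by (simp add: M_def simp_rules r_neg)

lemmas M_pair = aM Mp pM MM orthogonal

lemma M_triple_rules:
  assumes "i \<in> carrier R"
  shows "z \<otimes> (\<rho> \<otimes> (M \<otimes> i)) = \<zero>" "M \<otimes> (b \<otimes> (z \<otimes> i)) = \<zero>"
  using assms mult_assoc_rule[OF \<rho>M] mult_assoc_rule[OF Mbz] by (simp_all add: m_assoc)

lemmas all_rules = simp_rules M_pair M_pair[THEN mult_assoc_rule] \<rho>M Mbz M_triple_rules

section \<open>Invertibility of \<open>a - e\<close>\<close>

lemma e_idem: "e \<otimes> e = e"
  by (simp add: e_def all_rules a_ac r_neg r_neg1 r_neg2)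

lemma wa: "w \<otimes> a = p \<oplus> b \<otimes> z \<otimes> t"
  by (simp add: mult_a) (simp add: w_def all_rules, simp add: M_def all_rules a_ac r_neg r_neg1 r_neg2)

lemma we: "w \<otimes> e = p \<oplus> b \<otimes> z \<otimes> t \<ominus> \<one>"
  by (simp add: w_def e_def all_rules) (simp add: M_def all_rules a_ac r_neg r_neg1 r_neg2)

lemma aw: "a \<otimes> w = c \<otimes> t \<oplus> b \<otimes> t \<ominus> b \<otimes> z \<otimes> \<rho> \<otimes> b \<otimes> t \<oplus> b \<otimes> z \<otimes> \<rho>"
  by (simp add: a_mult) (simp add: w_def all_rules a_ac r_neg r_neg1 r_neg2)

lemma ew: "e \<otimes> w = M \<otimes> (b \<otimes> t \<oplus> p \<ominus> \<one>) \<ominus> s \<otimes> z \<otimes> t"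
proof -
  \<comment> \<open>The summands of \<open>w\<close> begin with \<open>p + bzt\<close>,
    \<open>M\<close> and \<open>bzt\<close>: \<open>e\<close> kills the first, fixes the second and
    sends the third to \<open>-szt\<close>.\<close>
  have 1: "e \<otimes> (p \<oplus> b \<otimes> z \<otimes> t) = \<zero>"
    by (simp add: e_def all_rules r_neg)
  have 2: "e \<otimes> M = M"
    by (simp add: e_def all_rules)
  have 3: "e \<otimes> (b \<otimes> z \<otimes> t) = \<ominus> (s \<otimes> z \<otimes> t)"
    by (simp add: e_def all_rules)
  show ?thesis
    unfolding w_def
    by (simp add: r_distr[of _ _ e] 1 2 3 flip: m_assoc) (simp add: minus_eq)
qed

lemma inverse_u: "(a \<ominus> e) \<otimes> w = \<one>" "w \<otimes> (a \<ominus> e) = \<one>"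
proof -
  show "(a \<ominus> e) \<otimes> w = \<one>"
    by (simp add: minus_eq l_distr l_minus aw ew) (simp add: M_def all_rules a_ac r_neg r_neg1 r_neg2)
  show "w \<otimes> (a \<ominus> e) = \<one>"
    by (simp add: minus_eq r_distr r_minus wa we) (simp add: minus_add a_ac r_neg r_neg1 r_neg2)
qed

lemma special_clean: "special_clean R a e (a \<ominus> e) w"
proof
  show "e \<otimes> (w \<otimes> a) = \<zero>"
    by (simp add: wa e_def all_rules r_neg)
  show "a = e \<oplus> (a \<ominus> e)"
    by (simp add: minus_eq a_lcomm r_neg)
qed (simp_all add: e_idem inverse_u)

text \<open>Left multiplication by \<open>ztr\<close> annihilates \<open>aaR\<close>, because
  \<open>ztra = zt\<close> and \<open>zta = ztc = 0\<close>, but it detects the elements of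
  \<open>aeR\<close>.\<close>

lemma aa_disjoint_ae:
  "principal_right_ideal R (a \<otimes> a) \<inter> principal_right_ideal R (a \<otimes> e) = {\<zero>}"
proof (rule principal_right_ideals_disjoint)
  fix i j assume ij: "i \<in> carrier R" "j \<in> carrier R" "a \<otimes> a \<otimes> i = a \<otimes> e \<otimes> j"
  \<comment> \<open>As \<open>aM = 0\<close>, only the \<open>s\<close>-terms of \<open>e\<close>
    survive in \<open>aej\<close>, which becomes \<open>asy\<close>; then \<open>ztr\<close> sends
    \<open>asy\<close> back to \<open>y\<close>.\<close>
  define y where "y = z \<otimes> (t \<ominus> \<rho>) \<otimes> j"
  have y: "y \<in> carrier R"
    using ij(2) by (simp add: y_def)
  have pa: "p \<otimes> (a \<otimes> i) = c \<otimes> i"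
    using ij(1) by (simp add: c_def m_assoc)
  have ae: "a \<otimes> e \<otimes> j = a \<otimes> (s \<otimes> y)"
    using ij(2) by (simp add: y_def e_def all_rules)
  have "z \<otimes> (t \<otimes> (r \<otimes> (a \<otimes> (a \<otimes> i)))) = \<zero>"
    using ij(1) by (simp add: ra_mult pa all_rules r_neg)
  moreover have "z \<otimes> (t \<otimes> (r \<otimes> (a \<otimes> (s \<otimes> y)))) = y"
    using ij(2) by (simp add: ra_mult y_def all_rules)
  ultimately have "y = \<zero>"
    using ij ae by (simp add: m_assoc)
  then show "a \<otimes> a \<otimes> i = \<zero>"
    using ij(3) ae by simp
qed simp_all

end

section \<open>Implications between the six conditions\<close>

theorem theorem3p14:
  fixes R (structure) and a :: 'a
  assumes "ring R" and "a \<in> carrier R"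
  shows "all_equivalent
   [\<exists>u \<in> Units R. a \<otimes> u \<otimes> a = a \<and>
      (let e = u \<otimes> a in unit_regular (corner R e) (e \<otimes> a \<otimes> e)),
    \<exists>r \<in> carrier R. a \<otimes> r \<otimes> a = a \<and>
      (let e = r \<otimes> a in unit_regular (corner R e) (e \<otimes> a \<otimes> e)),
    \<exists>g v. idempotent_element R g \<and> v \<in> Units R \<and>
      (let h = \<one> \<ominus> g in
        g = g \<otimes> v \<otimes> a \<and>
        h = \<ominus> (h \<otimes> v \<otimes> (\<one> \<ominus> a)) \<and>
        h \<otimes> v \<otimes> h = \<ominus> h \<and>
        g \<otimes> v \<otimes> h \<otimes> v \<otimes> g \<otimes> v \<otimes> h = \<ominus> (g \<otimes> v \<otimes> h)),
    \<exists>e u. idempotent_element R e \<and> u \<in> Units R \<and> a = e \<oplus> u \<and>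
      principal_right_ideal R a \<inter> principal_right_ideal R e = {\<zero>} \<and>
      principal_right_ideal R (a [^] (2::nat)) \<inter> principal_right_ideal R (a \<otimes> e) = {\<zero>},
    \<exists>e u. idempotent_element R e \<and> u \<in> Units R \<and> a = e \<oplus> u \<and>
      principal_right_ideal R a \<inter> principal_right_ideal R e = {\<zero>} \<and>
      principal_right_ideal R (a [^] (2::nat)) \<inter> principal_right_ideal R (a \<otimes> e \<otimes> a) = {\<zero>},
    \<exists>e u. idempotent_element R e \<and> u \<in> Units R \<and> a = e \<oplus> u \<and>
      a \<otimes> inv u \<otimes> a = a \<and>
      a [^] (2::nat) \<otimes> (inv u) [^] (2::nat) \<otimes> a [^] (2::nat) = a [^] (2::nat)]"
  (is "all_equivalent [?P1, ?P2, ?P3, ?P4, ?P5, ?P6]")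
proof -
  interpret ring R by fact
  note a = \<open>a \<in> carrier R\<close>
  have sq: "x [^] (2::nat) = x \<otimes> x" if "x \<in> carrier R" for x
    using that by (simp add: numeral_2_eq_2)
  have "?P1 \<Longrightarrow> ?P2"
    by blast
  moreover have "?P2 \<Longrightarrow> ?P4"
  proof -
    assume ?P2
    then obtain r where r: "r \<in> carrier R" "a \<otimes> r \<otimes> a = a"
      and reg: "unit_regular (corner R (r \<otimes> a)) (r \<otimes> a \<otimes> a \<otimes> (r \<otimes> a))"
      by (auto simp: Let_def)
    define p where "p = r \<otimes> a"
    have p: "idempotent_element R p"
      using r a by (simp add: idempotent_element_def p_def) (simp add: m_assoc)
    have "p \<otimes> a \<otimes> p = p \<otimes> a"
      using r a by (simp add: p_def m_assoc)
    with reg obtain t where t: "t \<in> Units (corner R p)" "p \<otimes> a \<otimes> t \<otimes> (p \<otimes> a) = p \<otimes> a"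
      by (auto simp: unit_regular_def p_def)
    then obtain s where "s \<in> carrier (corner R p)" "t \<in> carrier (corner R p)"
      "t \<otimes> s = p" "s \<otimes> t = p"
      by (auto simp: Units_def)
    with r a p t(2) interpret corner_unit_regular R a r p t s
      by unfold_locales (auto simp: mem_corner_iff p_def)
    interpret sc: special_clean R a e "a \<ominus> e" w
      by (rule special_clean)
    have "a \<ominus> e \<in> Units R"
      using inverse_u by (auto simp: Units_def)
    moreover have "idempotent_element R e"
      by (simp add: idempotent_element_def e_idem)
    ultimately show ?P4
      using sc.decomp sc.a_disjoint_e aa_disjoint_ae by (auto simp: sq)
  qed
  moreover have "?P4 \<Longrightarrow> ?P5"
  proof -
    assume ?P4
    then obtain e u where e: "idempotent_element R e" "u \<in> Units R" "a = e \<oplus> u"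
      "principal_right_ideal R a \<inter> principal_right_ideal R e = {\<zero>}"
      and ae: "principal_right_ideal R (a [^] (2::nat)) \<inter> principal_right_ideal R (a \<otimes> e) = {\<zero>}"
      by blast
    have [simp]: "e \<in> carrier R"
      using e(1) by (simp add: idempotent_element_def)
    have "principal_right_ideal R (a [^] (2::nat)) \<inter> principal_right_ideal R (a \<otimes> e \<otimes> a) = {\<zero>}"
    proof (rule principal_right_ideals_disjoint)
      fix i j assume ij: "i \<in> carrier R" "j \<in> carrier R" "a [^] (2::nat) \<otimes> i = a \<otimes> e \<otimes> a \<otimes> j"
      show "a [^] (2::nat) \<otimes> i = \<zero>"
        by (rule principal_right_ideals_disjointD[OF ae, of _ "a \<otimes> j"]) (use ij a in \<open>simp_all add: m_assoc\<close>)
    qed (use a in simp_all)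
    with e show ?P5
      by blast
  qed
  moreover have "?P5 \<Longrightarrow> ?P6"
  proof -
    assume ?P5
    then obtain e u where e: "idempotent_element R e" "u \<in> Units R" "a = e \<oplus> u"
      "principal_right_ideal R a \<inter> principal_right_ideal R e = {\<zero>}"
      and aea: "principal_right_ideal R (a [^] (2::nat)) \<inter> principal_right_ideal R (a \<otimes> e \<otimes> a) = {\<zero>}"
      by blast
    interpret special_clean R a e u "inv u"
      using e by (rule special_cleanI_disjoint)
    let ?x = "inv u \<otimes> inv u \<otimes> (a \<otimes> a)"
    \<comment> \<open>The defect of the wanted equation is thereby a right multiple of both
      \<open>aa\<close> and \<open>aea\<close>.\<close>
    have "a [^] (2::nat) \<otimes> (?x \<ominus> \<one>) = a \<otimes> e \<otimes> a \<otimes> ?x"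
      using double_square by (simp add: sq minus_eq r_distr r_minus a_ac r_neg2)
    moreover from this have "a [^] (2::nat) \<otimes> (?x \<ominus> \<one>) = \<zero>"
      by (rule principal_right_ideals_disjointD[OF aea, rotated 2]) simp_all
    ultimately have "a \<otimes> a \<otimes> ?x = a \<otimes> a"
      using double_square by simp
    then have "a [^] (2::nat) \<otimes> (inv u) [^] (2::nat) \<otimes> a [^] (2::nat) = a [^] (2::nat)"
      by (simp add: sq m_assoc)
    moreover have "a \<otimes> inv u \<otimes> a = a"
      by (simp add: m_assoc awa)
    ultimately show ?P6
      using e(1-3) by blast
  qed
  moreover have "?P6 \<Longrightarrow> ?P1"
  proof -
    assume ?P6
    then obtain e u where e: "idempotent_element R e" "u \<in> Units R" "a = e \<oplus> u"
      "a \<otimes> inv u \<otimes> a = a"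
      and sq6: "a [^] (2::nat) \<otimes> (inv u) [^] (2::nat) \<otimes> a [^] (2::nat) = a [^] (2::nat)"
      by blast
    interpret special_clean R a e u "inv u"
      using e by (rule special_cleanI)
    have "unit_regular (corner R (inv u \<otimes> a)) (inv u \<otimes> a \<otimes> a \<otimes> (inv u \<otimes> a))"
      by (rule unit_regular_corner) (use sq6 in \<open>simp add: sq m_assoc\<close>)
    with e(2,4) show ?P1
      by (auto simp: Let_def)
  qed
  moreover have "?P4 \<Longrightarrow> ?P3"
  proof -
    assume ?P4
    then obtain e u where e: "idempotent_element R e" "u \<in> Units R" "a = e \<oplus> u"
      "principal_right_ideal R a \<inter> principal_right_ideal R e = {\<zero>}"
      and ae: "principal_right_ideal R (a [^] (2::nat)) \<inter> principal_right_ideal R (a \<otimes> e) = {\<zero>}"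
      by blast
    define w where "w = inv u"
    interpret special_clean R a e u w
      unfolding w_def using e by (rule special_cleanI_disjoint)
    define h where "h = w \<otimes> e \<otimes> u"
    have h: "h \<in> carrier R"
      by (simp add: h_def)
    have aewwe: "a \<otimes> (e \<otimes> (w \<otimes> (w \<otimes> e))) = \<zero>"
    proof -
      \<comment> \<open>Expanding the inner \<open>aw\<close> as \<open>1 + ew\<close> leaves
        \<open>awe + aewwe\<close>, and \<open>awe = 0\<close>; thus \<open>aewwe\<close> lies in
        both ideals.\<close>
      have *: "a [^] (2::nat) \<otimes> (w \<otimes> (w \<otimes> e)) = a \<otimes> e \<otimes> (w \<otimes> (w \<otimes> e))"
        by (simp add: sq m_assoc aw_mult[of "w \<otimes> e"] r_distr awe)
      from principal_right_ideals_disjointD[OF ae _ _ this] show ?thesis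
        by (simp add: * m_assoc)
    qed
    have hh: "h \<otimes> h = h"
      by (simp add: h_def simp_rules)
    have g: "idempotent_element R (\<one> \<ominus> h)"
      using h by (simp add: idempotent_element_def minus_eq l_distr r_distr l_minus r_minus hh
          minus_add r_neg l_neg)
    have h_eq: "\<one> \<ominus> (\<one> \<ominus> h) = h"
      using h by (simp add: minus_eq minus_add r_neg2)
    have hwa: "h \<otimes> w \<otimes> a = w \<otimes> e \<oplus> h"
      by (simp add: h_def simp_rules) (simp add: decomp r_distr idem)
    have hw: "h \<otimes> w = w \<otimes> e"
      by (simp add: h_def simp_rules)
    have "\<one> \<ominus> h = (\<one> \<ominus> h) \<otimes> w \<otimes> a"
    proof -
      have "(\<one> \<ominus> h) \<otimes> w \<otimes> a = w \<otimes> a \<ominus> h \<otimes> w \<otimes> a"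
        using h by (simp add: minus_eq l_distr l_minus)
      then show ?thesis
        using h by (simp add: hwa wa minus_eq minus_add a_ac r_neg r_neg2)
    qed
    moreover have "h = \<ominus> (h \<otimes> w \<otimes> (\<one> \<ominus> a))"
      using h hwa by (simp add: hw minus_eq r_distr r_minus minus_add r_neg1)
    moreover have "h \<otimes> w \<otimes> h = \<ominus> h"
      by (simp add: h_def simp_rules l_minus r_minus)
    moreover have "w \<in> Units R"
      using e(2) by (simp add: w_def)
    moreover have "(\<one> \<ominus> h) \<otimes> w \<otimes> h \<otimes> w \<otimes> (\<one> \<ominus> h) \<otimes> w \<otimes> h = \<ominus> ((\<one> \<ominus> h) \<otimes> w \<otimes> h)"
      using aewwe gvh_iff unfolding h_def by simp
    ultimately show ?P3
      using g unfolding Let_def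
      by - (rule exI[of _ "\<one> \<ominus> h"], rule exI[of _ w], unfold h_eq, blast)
  qed
  moreover have "?P3 \<Longrightarrow> ?P6"
  proof -
    assume ?P3
    then obtain g v where gv: "idempotent_element R g" "v \<in> Units R" "g = g \<otimes> v \<otimes> a"
      and "\<one> \<ominus> g = \<ominus> ((\<one> \<ominus> g) \<otimes> v \<otimes> (\<one> \<ominus> a))"
        "(\<one> \<ominus> g) \<otimes> v \<otimes> (\<one> \<ominus> g) = \<ominus> (\<one> \<ominus> g)"
        "g \<otimes> v \<otimes> (\<one> \<ominus> g) \<otimes> v \<otimes> g \<otimes> v \<otimes> (\<one> \<ominus> g) = \<ominus> (g \<otimes> v \<otimes> (\<one> \<ominus> g))"
      by (auto simp: Let_def)
    moreover define h where "h = \<one> \<ominus> g"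
    ultimately have h: "h = \<ominus> (h \<otimes> v \<otimes> (\<one> \<ominus> a))" "h \<otimes> v \<otimes> h = \<ominus> h"
      and gvh: "g \<otimes> v \<otimes> h \<otimes> v \<otimes> g \<otimes> v \<otimes> h = \<ominus> (g \<otimes> v \<otimes> h)"
      by simp_all
    define u where "u = inv v"
    \<comment> \<open>Conjugation by the unit inverts the passage \<open>h = veu\<close> from a
      clean decomposition to (3).\<close>
    define e where "e = u \<otimes> h \<otimes> v"
    have u: "u \<in> Units R" "inv u = v" "u \<otimes> v = \<one>" "v \<otimes> u = \<one>"
      using gv(2) by (simp_all add: u_def)
    have [simp]: "g \<in> carrier R" "v \<in> carrier R" "u \<in> carrier R" "h \<in> carrier R" "e \<in> carrier R"
      "a \<in> carrier R"
      using gv u(1) a by (auto simp: idempotent_element_def h_def e_def)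
    have gg: "g \<otimes> g = g"
      using gv(1) by (simp add: idempotent_element_def)
    have hh: "h \<otimes> h = h"
      by (simp add: h_def minus_eq l_distr r_distr l_minus r_minus gg minus_add r_neg l_neg)
    have g_eq: "g = \<one> \<ominus> h"
      by (simp add: h_def minus_eq minus_add r_neg2)
    have "h = h \<otimes> v \<otimes> a \<ominus> h \<otimes> v"
      using h(1) by (simp add: minus_eq r_distr r_minus minus_add a_comm)
    then have hva: "h \<otimes> v \<otimes> a = h \<oplus> h \<otimes> v"
      by (metis eq_addI a_comm m_closed \<open>h \<in> carrier R\<close> \<open>v \<in> carrier R\<close> \<open>a \<in> carrier R\<close>)
    \<comment> \<open>Splitting \<open>1 = g + h\<close> lets the first two equations of (3)
      evaluate \<open>va\<close>; multiplying the result by \<open>u\<close> gives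
      \<open>a = u + e\<close>.\<close>
    have "v \<otimes> a = (g \<oplus> h) \<otimes> v \<otimes> a"
      by (simp add: g_eq minus_eq a_assoc l_neg)
    also have "\<dots> = g \<otimes> v \<otimes> a \<oplus> h \<otimes> v \<otimes> a"
      by (simp add: l_distr)
    also have "\<dots> = (g \<oplus> h) \<oplus> h \<otimes> v"
      by (simp add: gv(3)[symmetric] hva a_assoc)
    also have "g \<oplus> h = \<one>"
      by (simp add: g_eq minus_eq a_assoc l_neg)
    finally have va: "v \<otimes> a = \<one> \<oplus> h \<otimes> v" .
    have "a = u \<otimes> (v \<otimes> a)"
      by (simp add: u flip: m_assoc)
    then have decomp: "a = e \<oplus> u"
      by (simp add: va e_def r_distr m_assoc a_comm)
    have e: "idempotent_element R e"
      by (simp add: idempotent_element_def e_def m_assoc mult_assoc_rule[OF u(4)] mult_assoc_rule[OF hh])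
    interpret special_clean R a e u v
    proof
      \<comment> \<open>The product is \<open>uhv(1 + hv)\<close>, whose two terms cancel by
        \<open>hvh = -h\<close>.\<close>
      show "e \<otimes> (v \<otimes> a) = \<zero>"
        using mult_assoc_rule[OF h(2)]
        by (simp add: va e_def r_distr m_assoc l_minus r_minus r_neg)
    qed (use u e decomp in \<open>auto simp: idempotent_element_def\<close>)
    have h_eq: "h = v \<otimes> e \<otimes> u"
      by (simp add: e_def m_assoc u mult_assoc_rule[OF u(4)])
    have "a \<otimes> (e \<otimes> (v \<otimes> (v \<otimes> e))) = \<zero>"
      using gvh gvh_iff unfolding h_eq[symmetric] g_eq[symmetric] by simp
    then have "a \<otimes> a \<otimes> (v \<otimes> v \<otimes> (a \<otimes> a)) = a \<otimes> a"
      by (rule aewwe_imp_double_square)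
    then have "a [^] (2::nat) \<otimes> (inv u) [^] (2::nat) \<otimes> a [^] (2::nat) = a [^] (2::nat)"
      by (simp add: sq m_assoc u(2))
    moreover have "a \<otimes> inv u \<otimes> a = a"
      by (simp add: m_assoc awa u(2))
    ultimately show ?P6
      using e u(1) decomp by blast
  qed
  ultimately show ?thesis
    by (rule all_equivalent_six)
qed

end
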